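(* Let $\Omega\subseteq\mathbb{R}^d$ be open, let $p(\cdot)\in\mathcal{P}$ with $p_+<\infty$ and $p(\cdot)\in LH_0$, and let $0<q\le\infty$. If there exists $x_0\in\Omega$ such that $p(x_0)=p_-$, then for all real $r>p_-$: 1. $L_{p(\cdot)}(\Omega)\not\hookrightarrow L_r(\Omega)$, and 2. $L_{p(\cdot),q}(\Omega)\not\hookrightarrow L_{r,s}(\Omega)$ for all $0<s\le\infty$.
   Context: $\mu$ is Lebesgue measure on $\Omega$; $\chi_A$ is the characteristic function of $A$. $X_1\hookrightarrow X_2$ means $X_1\subseteq X_2$ with continuous inclusion, i.e. $\|f\|_{X_2}\le c\|f\|_{X_1}$ for some $c>0$ and all $f\in X_1$; $\not\hookrightarrow$ is its negation. For a measurable $p(\cdot):\Omega\to(0,\infty)$ put $p_-=\operatorname{ess\,inf}_{x\in\Omega}p(x)$, $p_+=\operatorname{ess\,sup}_{x\in\Omega}p(x)$. $\mathcal{P}$ is the set of such functions with $p_->0$ (exponent functions). Log-Hölder continuity: $r(\cdot)\in LH_0\{x_0\}$ (locally log-Hölder continuous at $x_0\in\Omega$) if there is $C_0>0$ with $|r(x)-r(x_0)|\le\frac{C_0}{-\log(|x-x_0|)}$ for all $x\in\Omega$ with $|x-x_0|<1/2$. $r(\cdot)\in LH_0$ if this holds for all $x_0\in\Omega$. Variable Lebesgue space $L_{p(\cdot)}(\Omega)$: with $\varrho_{p(\cdot)}(f)=\int_\Omega|f(x)|^{p(x)}\,dx$, it consists of the measurable $f$ with $\varrho_{p(\cdot)}(f/\lambda)<\infty$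 for some $\lambda>0$, with quasi-norm $\|f\|_{p(\cdot)}=\inf\{\lambda>0:\varrho_{p(\cdot)}(f/\lambda)\le1\}$. Variable Lorentz space $L_{p(\cdot),q}(\Omega)$: the measurable $f:\Omega\to\mathbb{R}$ with finite quasi-norm $$\|f\|_{L_{p(\cdot),q}}=\left(\int_0^\infty u^q\,\|\chi_{\{|f|>u\}}\|_{p(\cdot)}^q\,\frac{du}{u}\right)^{1/q}\ (0<q<\infty),\qquad \|f\|_{L_{p(\cdot),\infty}}=\sup_{u>0}u\,\|\chi_{\{|f|>u\}}\|_{p(\cdot)}.$$ Classical Lorentz space $L_{r,s}(\Omega)$: quasi-norm $\|f\|_{L_{r,s}}=\left(\int_0^\infty(t^{1/r}f^*(t))^s\frac{dt}{t}\right)^{1/s}$ for $0<s<\infty$ and $\sup_{t>0}t^{1/r}f^*(t)$ for $s=\infty$, where $f^*(t)=\inf\{\sigma>0:\mu(\{|f|>\sigma\})\le t\}$. $L_r(\Omega)$ is the usual Lebesgue space. *)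

theory Defs
  imports "HOL-Analysis.Analysis" "HOL-Probability.Essential_Supremum"
begin

definition essinf :: "'a measure \<Rightarrow> ('a \<Rightarrow> ereal) \<Rightarrow> ereal" where
  "essinf M f = Sup {z. AE x in M. z \<le> f x}"

definition exponent_inf :: "'a::euclidean_space set \<Rightarrow> ('a \<Rightarrow> real) \<Rightarrow> ereal" where
  "exponent_inf \<Omega> p = essinf (lebesgue_on \<Omega>) (\<lambda>x. ereal (p x))"

definition exponent_sup :: "'a::euclidean_space set \<Rightarrow> ('a \<Rightarrow> real) \<Rightarrow> ereal" where
  "exponent_sup \<Omega> p = esssup (lebesgue_on \<Omega>) (\<lambda>x. ereal (p x))"

definition exponent_functions :: "'a::euclidean_space set \<Rightarrow> ('a \<Rightarrow> real) set" where
  "exponent_functions \<Omega> =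
     {p \<in> borel_measurable (lebesgue_on \<Omega>). (\<forall>x\<in>\<Omega>. 0 < p x) \<and> 0 < exponent_inf \<Omega> p}"

text \<open>At \<open>x = x0\<close> the bound reads \<open>0 \<le> C / - ln 0\<close>, which holds since \<open>ln 0 = 0\<close> and
  division by zero yields zero; this agrees with the usual reading \<open>- log 0 = \<infinity>\<close>.\<close>

definition log_Hoelder_at :: "'a::euclidean_space set \<Rightarrow> 'a \<Rightarrow> ('a \<Rightarrow> real) \<Rightarrow> bool" where
  "log_Hoelder_at \<Omega> x0 r \<longleftrightarrow>
     (\<exists>C>0. \<forall>x\<in>\<Omega>. norm (x - x0) < 1/2 \<longrightarrow> \<bar>r x - r x0\<bar> \<le> C / (- ln (norm (x - x0))))"

definition log_Hoelder :: "'a::euclidean_space set \<Rightarrow> ('a \<Rightarrow> real) \<Rightarrow> bool" where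
  "log_Hoelder \<Omega> r \<longleftrightarrow> (\<forall>x0\<in>\<Omega>. log_Hoelder_at \<Omega> x0 r)"

text \<open>Powers of extended nonnegative reals; only used with positive exponents, for which
  \<open>\<infinity>\<close> to the power \<open>a\<close> is \<open>\<infinity>\<close>.\<close>

definition epowr :: "ennreal \<Rightarrow> real \<Rightarrow> ennreal" where
  "epowr x a = (if x = \<infinity> then \<infinity> else ennreal (enn2real x powr a))"

text \<open>A quasi-normed function space is represented by its carrier together with its quasi-norm.
  Elements are functions rather than classes modulo null sets, and values outside of \<open>\<Omega>\<close>
  are irrelevant; neither affects continuous inclusions between the spaces below.\<close>

type_synonym 'a fspace = "('a \<Rightarrow> real) set \<times> (('a \<Rightarrow> real) \<Rightarrow> ennreal)"

definition continuously_embedded :: "'a fspace \<Rightarrow> 'a fspace \<Rightarrow> bool"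
    (infix \<open>\<hookrightarrow>\<close> 50) where
  "X \<hookrightarrow> Y \<longleftrightarrow>
     fst X \<subseteq> fst Y \<and> (\<exists>c::real. c > 0 \<and> (\<forall>f\<in>fst X. snd Y f \<le> ennreal c * snd X f))"

definition modular :: "'a::euclidean_space set \<Rightarrow> ('a \<Rightarrow> real) \<Rightarrow> ('a \<Rightarrow> real) \<Rightarrow> ennreal" where
  "modular \<Omega> p f = (\<integral>\<^sup>+x. ennreal (\<bar>f x\<bar> powr p x) \<partial>lebesgue_on \<Omega>)"

definition var_Lebesgue_norm ::
    "'a::euclidean_space set \<Rightarrow> ('a \<Rightarrow> real) \<Rightarrow> ('a \<Rightarrow> real) \<Rightarrow> ennreal" where
  "var_Lebesgue_norm \<Omega> p f =
     Inf {ennreal l | l::real. l > 0 \<and> modular \<Omega> p (\<lambda>x. f x / l) \<le> 1}"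

definition var_Lebesgue :: "'a::euclidean_space set \<Rightarrow> ('a \<Rightarrow> real) \<Rightarrow> 'a fspace" where
  "var_Lebesgue \<Omega> p =
     ({f \<in> borel_measurable (lebesgue_on \<Omega>).
         \<exists>l::real. l > 0 \<and> modular \<Omega> p (\<lambda>x. f x / l) < \<infinity>},
      var_Lebesgue_norm \<Omega> p)"

definition superlevel :: "'a set \<Rightarrow> ('a \<Rightarrow> real) \<Rightarrow> real \<Rightarrow> 'a set" where
  "superlevel \<Omega> f u = {x\<in>\<Omega>. \<bar>f x\<bar> > u}"

definition var_Lorentz_norm ::
    "'a::euclidean_space set \<Rightarrow> ('a \<Rightarrow> real) \<Rightarrow> ennreal \<Rightarrow> ('a \<Rightarrow> real) \<Rightarrow> ennreal" where
  "var_Lorentz_norm \<Omega> p q f =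
     (let N = (\<lambda>u. var_Lebesgue_norm \<Omega> p (indicator (superlevel \<Omega> f u))) in
      if q = \<infinity> then SUP u\<in>{0<..}. ennreal u * N u
      else epowr (\<integral>\<^sup>+u\<in>{0<..}. (ennreal (u powr enn2real q) * epowr (N u) (enn2real q) / ennreal u)
                    \<partial>lborel)
                 (1 / enn2real q))"

definition var_Lorentz ::
    "'a::euclidean_space set \<Rightarrow> ('a \<Rightarrow> real) \<Rightarrow> ennreal \<Rightarrow> 'a fspace" where
  "var_Lorentz \<Omega> p q =
     ({f \<in> borel_measurable (lebesgue_on \<Omega>). var_Lorentz_norm \<Omega> p q f < \<infinity>},
      var_Lorentz_norm \<Omega> p q)"

definition Lebesgue_norm ::
    "'a::euclidean_space set \<Rightarrow> real \<Rightarrow> ('a \<Rightarrow> real) \<Rightarrow> ennreal" where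
  "Lebesgue_norm \<Omega> r f = epowr (\<integral>\<^sup>+x. ennreal (\<bar>f x\<bar> powr r) \<partial>lebesgue_on \<Omega>) (1 / r)"

definition Lebesgue :: "'a::euclidean_space set \<Rightarrow> real \<Rightarrow> 'a fspace" where
  "Lebesgue \<Omega> r =
     ({f \<in> borel_measurable (lebesgue_on \<Omega>). Lebesgue_norm \<Omega> r f < \<infinity>}, Lebesgue_norm \<Omega> r)"

definition decreasing_rearrangement ::
    "'a::euclidean_space set \<Rightarrow> ('a \<Rightarrow> real) \<Rightarrow> real \<Rightarrow> ennreal" where
  "decreasing_rearrangement \<Omega> f t =
     Inf {ennreal \<sigma> | \<sigma>::real. \<sigma> > 0 \<and> emeasure (lebesgue_on \<Omega>) (superlevel \<Omega> f \<sigma>) \<le> ennreal t}"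

definition Lorentz_norm ::
    "'a::euclidean_space set \<Rightarrow> real \<Rightarrow> ennreal \<Rightarrow> ('a \<Rightarrow> real) \<Rightarrow> ennreal" where
  "Lorentz_norm \<Omega> r s f =
     (let g = (\<lambda>t. ennreal (t powr (1 / r)) * decreasing_rearrangement \<Omega> f t) in
      if s = \<infinity> then SUP t\<in>{0<..}. g t
      else epowr (\<integral>\<^sup>+t\<in>{0<..}. (epowr (g t) (enn2real s) / ennreal t) \<partial>lborel)
                 (1 / enn2real s))"

definition Lorentz :: "'a::euclidean_space set \<Rightarrow> real \<Rightarrow> ennreal \<Rightarrow> 'a fspace" where
  "Lorentz \<Omega> r s =
     ({f \<in> borel_measurable (lebesgue_on \<Omega>). Lorentz_norm \<Omega> r s f < \<infinity>}, Lorentz_norm \<Omega> r s)"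

end

theory Submission
  imports Defs
begin

text \<open>The characteristic functions of small balls around \<open>x0\<close> refute both embeddings. Fix
  \<open>p x0 < \<pi> < r\<close>. By continuity \<open>p \<le> \<pi>\<close> on every small ball \<open>B\<close> around \<open>x0\<close>, so the source
  quasi-norm of \<open>\<chi>\<^sub>B\<close> is at most a constant times \<open>\<mu>(B)\<close> to the power \<open>1/\<pi>\<close>, while the target
  quasi-norm is at least a positive constant times \<open>\<mu>(B)\<close> to the power \<open>1/r\<close>. As \<open>1/r < 1/\<pi>\<close>,
  shrinking \<open>B\<close> contradicts every embedding constant.\<close>

section \<open>Powers of extended reals and a criterion that rules out embeddings\<close>

lemma epowr_ennreal: "0 \<le> x \<Longrightarrow> epowr (ennreal x) a = ennreal (x powr a)"
  by (simp add: epowr_def)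

lemma epowr_mono: "x \<le> y \<Longrightarrow> 0 \<le> a \<Longrightarrow> epowr x a \<le> epowr y a"
  by (cases x; cases y) (auto simp: epowr_def top_unique intro!: ennreal_leI powr_mono2)

text \<open>In the application \<open>m e\<close> is the measure of the support of the test function
  \<open>f e\<close>. An embedding with constant \<open>c\<close> would force
  \<open>L * m e powr b <= c * K * m e powr a\<close>, hence
  \<open>L <= c * K * m e powr (a - b)\<close>. The right side tends to 0 because
  \<open>b < a\<close>, while \<open>L\<close> is a fixed positive number.\<close>

lemma not_continuously_embeddedI:
  fixes f :: "'b \<Rightarrow> 'a \<Rightarrow> real" and m :: "'b \<Rightarrow> real"
  assumes F: "F \<noteq> bot" and m0: "(m \<longlongrightarrow> 0) F"
    and ev: "\<forall>\<^sub>F e in F. 0 < m e \<and> f e \<in> fst X \<and> snd X (f e) \<le> ennreal (K * m e powr a) \<and>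
               ennreal (L * m e powr b) \<le> snd Y (f e)"
    and L: "0 < L" and K: "0 \<le> K" and ba: "b < a"
  shows "\<not> X \<hookrightarrow> Y"
proof
  assume "X \<hookrightarrow> Y"
  then obtain c where c: "c > 0" "\<And>g. g \<in> fst X \<Longrightarrow> snd Y g \<le> ennreal c * snd X g"
    unfolding continuously_embedded_def by blast
  have "((\<lambda>e. m e powr (a - b)) \<longlongrightarrow> 0) F"
    by (rule tendsto_zero_powrI[OF m0 tendsto_const])
      (use ev ba in \<open>auto elim!: eventually_mono\<close>)
  then have "((\<lambda>e. c * K * m e powr (a - b)) \<longlongrightarrow> c * K * 0) F"
    by (intro tendsto_intros)
  then have "\<forall>\<^sub>F e in F. c * K * m e powr (a - b) < L"
    using L by (intro order_tendstoD) auto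
  with ev have "\<forall>\<^sub>F e in F. False"
  proof eventually_elim
    case (elim e)
    have "ennreal (L * m e powr b) \<le> ennreal c * snd X (f e)"
      using elim c(2)[of "f e"] by (auto intro: order_trans)
    also have "\<dots> \<le> ennreal c * ennreal (K * m e powr a)"
      using elim by (intro mult_left_mono) auto
    also have "\<dots> = ennreal (c * K * m e powr (a - b) * m e powr b)"
      using c K by (simp add: ennreal_mult' powr_add[symmetric] mult.assoc)
    finally have "L * m e powr b \<le> c * K * m e powr (a - b) * m e powr b"
      using c K by (subst (asm) ennreal_le_iff) auto
    then show False
      using elim by simp
  qed
  with F show False by simp
qed

section \<open>Upper bounds for the source quasi-norms of characteristic functions\<close>

lemma superlevel_indicator:
  assumes "B \<subseteq> \<Omega>" "0 \<le> u"
  shows "superlevel \<Omega> (indicator B) u = (if u < 1 then B else {})"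
  using assms by (auto simp: superlevel_def indicator_def split: if_splits)

lemma indicator_borel_measurable_lebesgue_on:
  assumes "\<Omega> \<in> sets lebesgue" "B \<in> sets lebesgue" "B \<subseteq> \<Omega>"
  shows "(indicator B :: _ \<Rightarrow> real) \<in> borel_measurable (lebesgue_on \<Omega>)"
  using assms by (intro borel_measurable_indicator) (simp add: sets_restrict_space_iff)

lemma emeasure_lebesgue_on_subset:
  assumes "\<Omega> \<in> sets lebesgue" "B \<in> lmeasurable" "B \<subseteq> \<Omega>"
  shows "emeasure (lebesgue_on \<Omega>) B = ennreal (measure lebesgue B)"
  using assms by (simp add: emeasure_restrict_space emeasure_eq_measure2)

text \<open>As the measure is at most 1, the scaled value on \<open>B\<close> is at least 1, so
  replacing the exponent \<open>p x\<close> by the larger \<pi> can only increase the power. The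
  scale is chosen so that the enlarged integrand is the reciprocal of the measure of
  \<open>B\<close>, which integrates to 1.\<close>

lemma modular_indicator_le_1:
  assumes \<Omega>: "\<Omega> \<in> sets lebesgue" and B: "B \<in> lmeasurable" "B \<subseteq> \<Omega>"
    and m: "0 < measure lebesgue B" "measure lebesgue B \<le> 1"
    and pi: "0 < \<pi>" and p: "\<And>x. x \<in> B \<Longrightarrow> p x \<le> \<pi>"
  shows "modular \<Omega> p (\<lambda>x. indicator B x / measure lebesgue B powr (1 / \<pi>)) \<le> 1"
proof -
  let ?m = "measure lebesgue B"
  have "modular \<Omega> p (\<lambda>x. indicator B x / ?m powr (1 / \<pi>))
      \<le> (\<integral>\<^sup>+x. ennreal (1 / ?m) * indicator B x \<partial>lebesgue_on \<Omega>)"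
    unfolding modular_def
  proof (intro nn_integral_mono)
    fix x
    show "ennreal (\<bar>indicator B x / ?m powr (1 / \<pi>)\<bar> powr p x) \<le> ennreal (1 / ?m) * indicator B x"
    proof (cases "x \<in> B")
      case True
      have "(1 / ?m powr (1 / \<pi>)) powr p x \<le> (1 / ?m powr (1 / \<pi>)) powr \<pi>"
        using m pi p[OF True] by (intro powr_mono) (auto simp: powr_le_one_le powr_le1)
      also have "\<dots> = 1 / ?m"
        using m pi by (simp add: powr_divide powr_powr)
      finally show ?thesis using True m by (simp add: ennreal_leI)
    qed simp
  qed
  also have "\<dots> = ennreal (1 / ?m) * ennreal ?m"
    using \<Omega> B by (subst nn_integral_cmult_indicator)
      (auto simp: sets_restrict_space_iff emeasure_lebesgue_on_subset)
  also have "\<dots> = 1"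
    using m by (simp flip: ennreal_mult')
  finally show ?thesis .
qed

lemma var_Lebesgue_norm_le:
  assumes "0 < l" "modular \<Omega> p (\<lambda>x. f x / l) \<le> 1"
  shows "var_Lebesgue_norm \<Omega> p f \<le> ennreal l"
  unfolding var_Lebesgue_norm_def using assms by (intro Inf_lower) auto

lemma var_Lebesgue_norm_indicator_empty:
  "var_Lebesgue_norm \<Omega> p (indicator {}) = 0"
proof (rule antisym[OF _ zero_le])
  show "var_Lebesgue_norm \<Omega> p (indicator {}) \<le> 0"
    \<comment> \<open>The infimum ranges over positive scales only, so 0 is approached, not
      attained. Every scale is admissible because \<open>0 powr p x\<close> is 0.\<close>
    by (rule ennreal_le_epsilon) (simp add: var_Lebesgue_norm_le modular_def)
qed

text \<open>The integrand is \<open>u powr (q - 1)\<close> with exponent above -1, hence integrable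
  at 0. Enlarging the domain to the closed interval gives an upper bound with the value of the power
  integral.\<close>

lemma nn_integral_powr_unit_interval:
  assumes "0 < (q::real)"
  shows "(\<integral>\<^sup>+u\<in>{0<..<1}. ennreal (u powr q / u) \<partial>lborel) \<le> ennreal (1 / q)"
proof -
  have "(\<integral>\<^sup>+u\<in>{0<..<1}. ennreal (u powr q / u) \<partial>lborel)
      \<le> (\<integral>\<^sup>+u\<in>{0..1}. ennreal (u powr (q - 1)) \<partial>lborel)"
    by (intro nn_integral_mono) (auto simp: indicator_def powr_diff)
  also have "\<dots> = ennreal (1 / q)"
    using has_integral_powr_from_0[of "q - 1" 1] assms
    by (intro nn_integral_has_integral_lebesgue') auto
  finally show ?thesis .
qed

text \<open>The superlevel sets are \<open>B\<close> for levels in (0,1) and empty from level 1 on.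
  For finite \<open>q\<close> the constant is therefore the \<open>q\<close>-th root of the integral
  of \<open>u powr (q - 1)\<close> over (0,1); for infinite \<open>q\<close> it is the supremum of
  \<open>u\<close> over (0,1).\<close>

lemma var_Lorentz_norm_indicator_le:
  assumes q: "0 < q" and B: "B \<subseteq> \<Omega>" and n: "0 \<le> n" "var_Lebesgue_norm \<Omega> p (indicator B) \<le> ennreal n"
  shows "var_Lorentz_norm \<Omega> p q (indicator B)
    \<le> ennreal ((if q = \<infinity> then 1 else (1 / enn2real q) powr (1 / enn2real q)) * n)"
proof (cases "q = \<infinity>")
  case True
  have "ennreal u * var_Lebesgue_norm \<Omega> p (indicator (superlevel \<Omega> (indicator B) u)) \<le> ennreal n"
    if "0 < u" for u
  proof (cases "u < 1")
    case u: True
    have "ennreal u * var_Lebesgue_norm \<Omega> p (indicator B) \<le> 1 * ennreal n"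
      using n that u by (intro mult_mono) auto
    then show ?thesis using u that B by (simp add: superlevel_indicator)
  qed (use that B in \<open>simp add: superlevel_indicator var_Lebesgue_norm_indicator_empty\<close>)
  then show ?thesis
    using True by (auto simp: var_Lorentz_norm_def intro!: SUP_least)
next
  case False
  define Q where "Q = enn2real q"
  have Q: "0 < Q"
    using q False by (auto simp: Q_def enn2real_positive_iff top.not_eq_extremum)
  let ?N = "\<lambda>u. var_Lebesgue_norm \<Omega> p (indicator (superlevel \<Omega> (indicator B) u))"
  have "(\<integral>\<^sup>+u\<in>{0<..}. (ennreal (u powr Q) * epowr (?N u) Q / ennreal u) \<partial>lborel)
      \<le> (\<integral>\<^sup>+u. ennreal (n powr Q) * (ennreal (u powr Q / u) * indicator {0<..<1} u) \<partial>lborel)"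
  proof (intro nn_integral_mono)
    fix u :: real
    show "ennreal (u powr Q) * epowr (?N u) Q / ennreal u * indicator {0<..} u
      \<le> ennreal (n powr Q) * (ennreal (u powr Q / u) * indicator {0<..<1} u)"
    proof (cases "0 < u \<and> u < 1")
      case True
      have "ennreal (u powr Q) * epowr (?N u) Q / ennreal u
          \<le> ennreal (u powr Q) * epowr (ennreal n) Q / ennreal u"
        using True B n Q
        by (intro divide_right_mono_ennreal mult_left_mono epowr_mono)
          (auto simp: superlevel_indicator)
      also have "\<dots> = ennreal (n powr Q) * ennreal (u powr Q / u)"
        using True n by (simp add: epowr_ennreal divide_ennreal mult.commute flip: ennreal_mult')
      finally show ?thesis using True by simp
    next
      \<comment> \<open>For u at most 0 the indicator vanishes; for u at least 1 the superlevel set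
        is empty and \<open>epowr 0 Q\<close> is 0.\<close>
      case False
      with B have "?N u = 0" if "0 < u"
        using that by (simp add: superlevel_indicator var_Lebesgue_norm_indicator_empty)
      then show ?thesis using False by (auto simp: indicator_def epowr_def)
    qed
  qed
  also have "\<dots> = ennreal (n powr Q) * (\<integral>\<^sup>+u\<in>{0<..<1}. ennreal (u powr Q / u) \<partial>lborel)"
    by (rule nn_integral_cmult) measurable
  also have "\<dots> \<le> ennreal (n powr Q) * ennreal (1 / Q)"
    by (intro mult_left_mono nn_integral_powr_unit_interval Q) auto
  also have "\<dots> = ennreal (1 / Q * n powr Q)"
    using Q by (simp add: mult.commute flip: ennreal_mult')
  finally have "var_Lorentz_norm \<Omega> p q (indicator B) \<le> epowr (ennreal (1 / Q * n powr Q)) (1 / Q)"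
    using False Q unfolding var_Lorentz_norm_def Let_def Q_def[symmetric] by (auto intro: epowr_mono)
  also have "\<dots> = ennreal ((1 / Q) powr (1 / Q) * n)"
    using Q n by (subst epowr_ennreal) (auto simp: powr_mult powr_powr powr_divide)
  finally show ?thesis
    using False by (simp add: Q_def)
qed

section \<open>Lower bounds for the target quasi-norms of characteristic functions\<close>

lemma Lebesgue_norm_indicator:
  assumes "\<Omega> \<in> sets lebesgue" "B \<in> lmeasurable" "B \<subseteq> \<Omega>"
  shows "Lebesgue_norm \<Omega> r (indicator B) = ennreal (measure lebesgue B powr (1 / r))"
proof -
  have "(\<integral>\<^sup>+x. ennreal (\<bar>indicator B x\<bar> powr r) \<partial>lebesgue_on \<Omega>)
      = (\<integral>\<^sup>+x. indicator B x \<partial>lebesgue_on \<Omega>)"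
    by (intro nn_integral_cong) (auto simp: indicator_def)
  also have "\<dots> = ennreal (measure lebesgue B)"
    using assms by (subst nn_integral_indicator)
      (auto simp: sets_restrict_space_iff emeasure_lebesgue_on_subset)
  finally show ?thesis by (simp add: Lebesgue_norm_def epowr_ennreal)
qed

lemma decreasing_rearrangement_indicator_ge:
  assumes "\<Omega> \<in> sets lebesgue" "B \<in> lmeasurable" "B \<subseteq> \<Omega>" "0 \<le> t" "t < measure lebesgue B"
  shows "1 \<le> decreasing_rearrangement \<Omega> (indicator B) t"
  unfolding decreasing_rearrangement_def
proof (rule Inf_greatest, clarify)
  fix \<sigma> :: real
  assume "0 < \<sigma>" "emeasure (lebesgue_on \<Omega>) (superlevel \<Omega> (indicator B) \<sigma>) \<le> ennreal t"
  with assms have "\<not> \<sigma> < 1"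
    by (auto simp: superlevel_indicator emeasure_lebesgue_on_subset)
  then show "1 \<le> ennreal \<sigma>" by simp
qed

text \<open>It suffices to look at \<open>t\<close> between \<open>\<mu>(B)/2\<close> and \<open>\<mu>(B)\<close>, where the rearrangement is at
  least 1.\<close>

lemma Lorentz_norm_indicator_ge:
  assumes \<Omega>: "\<Omega> \<in> sets lebesgue" and B: "B \<in> lmeasurable" "B \<subseteq> \<Omega>"
    and m: "0 < measure lebesgue B" and r: "0 < r" and s: "0 < s"
  shows "ennreal ((1 / 2) powr (1 / r) * (if s = \<infinity> then 1 else (1 / 2) powr (1 / enn2real s))
            * measure lebesgue B powr (1 / r))
    \<le> Lorentz_norm \<Omega> r s (indicator B)"
proof -
  let ?m = "measure lebesgue B"
  let ?g = "\<lambda>t. ennreal (t powr (1 / r)) * decreasing_rearrangement \<Omega> (indicator B) t"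
  have half: "(1 / 2) powr (1 / r) * ?m powr (1 / r) = (?m / 2) powr (1 / r)"
    by (simp flip: powr_mult)
  \<comment> \<open>The bound \<open>t < ?m\<close> is strict because the rearrangement is 0 at
    \<open>t = ?m\<close>. The endpoint \<open>?m / 2\<close> is included to serve as the witness
    for the supremum when \<open>s\<close> is infinite.\<close>
  have g: "ennreal ((?m / 2) powr (1 / r)) \<le> ?g t" if t: "?m / 2 \<le> t" "t < ?m" for t
  proof -
    have "ennreal ((?m / 2) powr (1 / r)) * 1 \<le> ?g t"
      using t m r \<Omega> B
      by (intro mult_mono decreasing_rearrangement_indicator_ge ennreal_leI powr_mono2) auto
    then show ?thesis by simp
  qed
  show ?thesis
  proof (cases "s = \<infinity>")
    case True
    have "ennreal ((?m / 2) powr (1 / r)) \<le> (SUP t\<in>{0<..}. ?g t)"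
      using m by (intro SUP_upper2[of "?m / 2"] g) auto
    then show ?thesis using True by (simp add: Lorentz_norm_def half)
  next
    case False
    define S where "S = enn2real s"
    have S: "0 < S"
      using s False by (auto simp: S_def enn2real_positive_iff top.not_eq_extremum)
    \<comment> \<open>On this interval \<open>1 / t\<close> is at least \<open>1 / ?m\<close>, so
      the integrand has a constant lower bound. The length \<open>?m / 2\<close> cancels
      \<open>?m\<close> and leaves the factor 1/2, whose root appears in the final constant.\<close>
    have "ennreal (((?m / 2) powr (1 / r)) powr S / 2)
        = (\<integral>\<^sup>+t. ennreal (((?m / 2) powr (1 / r)) powr S / ?m) * indicator {?m / 2..<?m} t \<partial>lborel)"
      using m by (subst nn_integral_cmult_indicator) (auto simp flip: ennreal_mult')
    also have "\<dots> \<le> (\<integral>\<^sup>+t\<in>{0<..}. (epowr (?g t) S / ennreal t) \<partial>lborel)"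
    proof (intro nn_integral_mono)
      fix t
      show "ennreal (((?m / 2) powr (1 / r)) powr S / ?m) * indicator {?m / 2..<?m} t
        \<le> epowr (?g t) S / ennreal t * indicator {0<..} t"
      proof (cases "t \<in> {?m / 2..<?m}")
        case True
        then have t: "0 < t" using m by auto
        have "ennreal (((?m / 2) powr (1 / r)) powr S / ?m)
            \<le> ennreal (((?m / 2) powr (1 / r)) powr S / t)"
          using True t by (intro ennreal_leI divide_left_mono) auto
        also have "\<dots> = epowr (ennreal ((?m / 2) powr (1 / r))) S / ennreal t"
          using t by (simp add: epowr_ennreal divide_ennreal)
        also have "\<dots> \<le> epowr (?g t) S / ennreal t"
          using True S by (intro divide_right_mono_ennreal epowr_mono g) auto
        finally show ?thesis using True t by simp
      qed simp
    qed
    finally have "epowr (ennreal (((?m / 2) powr (1 / r)) powr S / 2)) (1 / S)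
        \<le> Lorentz_norm \<Omega> r s (indicator B)"
      using False S unfolding Lorentz_norm_def Let_def S_def[symmetric] by (auto intro: epowr_mono)
    moreover have "epowr (ennreal (((?m / 2) powr (1 / r)) powr S / 2)) (1 / S)
        = ennreal ((?m / 2) powr (1 / r) * (1 / 2) powr (1 / S))"
      using S by (subst epowr_ennreal) (auto simp: powr_divide powr_powr powr_mult)
    ultimately show ?thesis
      using False by (simp add: S_def mult_ac flip: half)
  qed
qed

section \<open>Continuity of the exponent at a point, and shrinking balls\<close>

lemma log_Hoelder_at_imp_continuous:
  assumes "log_Hoelder_at \<Omega> x0 p" "open \<Omega>" "x0 \<in> \<Omega>"
  shows "continuous (at x0) p"
proof -
  obtain C where C: "\<And>x. x \<in> \<Omega> \<Longrightarrow> norm (x - x0) < 1/2 \<Longrightarrow> \<bar>p x - p x0\<bar> \<le> C / (- ln (norm (x - x0)))"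
    using assms(1) unfolding log_Hoelder_at_def by blast
  have "((\<lambda>x. norm (x - x0)) \<longlongrightarrow> norm (x0 - x0)) (at x0)"
    by (intro tendsto_intros)
  \<comment> \<open>In the punctured neighbourhood the distance tends to 0 through positive values,
    so \<open>- ln\<close> of it tends to infinity and the log-Hoelder bound tends to 0. The
    convention \<open>ln 0 = 0\<close> never enters.\<close>
  then have norm: "filterlim (\<lambda>x. norm (x - x0)) (at_right 0) (at x0)"
    by (auto simp: filterlim_at eventually_at intro: exI[of _ 1])
  then have "((\<lambda>x. C / (- ln (norm (x - x0)))) \<longlongrightarrow> 0) (at x0)"
    by (intro tendsto_divide_0[OF tendsto_const] filterlim_at_top_imp_at_infinity)
      (rule filterlim_compose[OF _ norm],
       simp add: filterlim_uminus_at_top ln_at_0)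
  moreover have "\<forall>\<^sub>F x in at x0. norm (p x - p x0) \<le> C / (- ln (norm (x - x0)))"
  proof -
    have "\<forall>\<^sub>F x in at x0. x \<in> \<Omega> \<inter> ball x0 (1/2)"
      using assms by (intro eventually_at_in_open') auto
    then show ?thesis
      by eventually_elim (use C in \<open>auto simp: dist_norm norm_minus_commute\<close>)
  qed
  ultimately have "((\<lambda>x. p x - p x0) \<longlongrightarrow> 0) (at x0)"
    by (rule Lim_null_comparison[rotated])
  then show ?thesis
    unfolding continuous_at by (rule LIM_zero_cancel)
qed

lemma tendsto_measure_ball_0:
  "((\<lambda>e. measure lebesgue (ball (x0::'a::euclidean_space) e)) \<longlongrightarrow> 0) (at_right 0)"
proof -
  have "((\<lambda>e::real. unit_ball_vol (real DIM('a)) * e ^ DIM('a))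
      \<longlongrightarrow> unit_ball_vol (real DIM('a)) * 0 ^ DIM('a)) (at_right 0)"
    by (intro tendsto_intros)
  \<comment> \<open>The power of 0 vanishes because a Euclidean space has positive
    dimension.\<close>
  then have "((\<lambda>e::real. unit_ball_vol (real DIM('a)) * e ^ DIM('a)) \<longlongrightarrow> 0) (at_right 0)"
    by (simp add: zero_power)
  moreover have "\<forall>\<^sub>F e::real in at_right 0. unit_ball_vol (real DIM('a)) * e ^ DIM('a)
      = measure lebesgue (ball x0 e)"
    using eventually_at_right_less[of 0] by eventually_elim (simp add: content_ball)
  ultimately show ?thesis
    by (rule Lim_transform_eventually)
qed

theorem corollary7p7:
  fixes \<Omega> :: "'a::euclidean_space set" and p :: "'a \<Rightarrow> real" and q :: ennreal
  assumes "open \<Omega>"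
    and "p \<in> exponent_functions \<Omega>"
    and "exponent_sup \<Omega> p < \<infinity>"
    and "log_Hoelder \<Omega> p"
    and "0 < q"
    and "\<exists>x0\<in>\<Omega>. ereal (p x0) = exponent_inf \<Omega> p"
  shows "\<forall>r::real. ereal r > exponent_inf \<Omega> p \<longrightarrow>
           \<not> (var_Lebesgue \<Omega> p \<hookrightarrow> Lebesgue \<Omega> r) \<and>
           (\<forall>s::ennreal. 0 < s \<longrightarrow> \<not> (var_Lorentz \<Omega> p q \<hookrightarrow> Lorentz \<Omega> r s))"
proof (intro allI impI)
  fix r :: real
  assume r: "ereal r > exponent_inf \<Omega> p"
  obtain x0 where x0: "x0 \<in> \<Omega>" "ereal (p x0) = exponent_inf \<Omega> p"
    using assms by blast
  have \<Omega>: "\<Omega> \<in> sets lebesgue" using assms(1) by auto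
  have "0 < p x0" using assms(2) x0 by (auto simp: exponent_functions_def)
  moreover have "p x0 < r" using r x0(2) by (metis less_ereal.simps(1))
  ultimately obtain \<pi> where \<pi>: "p x0 < \<pi>" "\<pi> < r" "0 < \<pi>" "0 < r"
    by (meson dense less_trans)
  then have powers: "1 / r < 1 / \<pi>" by (simp add: divide_strict_left_mono)
  define m where "m e = measure lebesgue (ball x0 e)" for e
  have "continuous (at x0) p"
    using assms x0 log_Hoelder_at_imp_continuous by (auto simp: log_Hoelder_def)
  \<comment> \<open>The full filter \<open>nhds x0\<close> is used because the balls contain their
    centre, where \<open>p x0 < \<pi>\<close> holds by choice.\<close>
  then have "\<forall>\<^sub>F x in nhds x0. p x < \<pi>"
    using \<pi> by (intro order_tendstoD(2)[of p "p x0"]) (auto simp: continuous_at tendsto_at_iff_tendsto_nhds)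
  moreover have "\<forall>\<^sub>F x in nhds x0. x \<in> \<Omega>"
    using assms x0 by (intro eventually_nhds_in_open)
  ultimately have "\<forall>\<^sub>F x in nhds x0. p x < \<pi> \<and> x \<in> \<Omega>"
    by eventually_elim auto
  then obtain d where d: "0 < d" "\<And>x. dist x x0 < d \<Longrightarrow> p x < \<pi> \<and> x \<in> \<Omega>"
    by (auto simp: eventually_nhds_metric)
  \<comment> \<open>These are the conditions under which \<open>modular_indicator_le_1\<close>
    applies to the ball: radii below \<open>d\<close> give the inclusion and the bound on
    \<open>p\<close>, and the vanishing volume gives measure at most 1.\<close>
  have small: "\<forall>\<^sub>F e in at_right 0. 0 < m e \<and> m e \<le> 1 \<and> ball x0 e \<subseteq> \<Omega> \<and> (\<forall>x\<in>ball x0 e. p x \<le> \<pi>)"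
  proof -
    have "\<forall>\<^sub>F e in at_right 0. m e < 1"
      unfolding m_def by (intro order_tendstoD(2)[OF tendsto_measure_ball_0]) simp
    moreover have "\<forall>\<^sub>F e in at_right 0. e \<in> {0<..<d}"
      using d(1) by (rule eventually_at_right_real)
    ultimately show ?thesis
    proof eventually_elim
      case (elim e)
      then have "p x < \<pi> \<and> x \<in> \<Omega>" if "x \<in> ball x0 e" for x
        using that d(2)[of x] by (auto simp: dist_commute)
      moreover have "0 < m e" using elim by (simp add: m_def content_ball_pos)
      ultimately show ?case using elim by (auto intro: less_imp_le)
    qed
  qed
  have m0: "(m \<longlongrightarrow> 0) (at_right 0)"
    unfolding m_def by (rule tendsto_measure_ball_0)
  let ?f = "\<lambda>e. indicator (ball x0 e) :: 'a \<Rightarrow> real"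
  have meas: "?f e \<in> borel_measurable (lebesgue_on \<Omega>)" if "ball x0 e \<subseteq> \<Omega>" for e
    using \<Omega> that by (intro indicator_borel_measurable_lebesgue_on) auto
  have modular: "modular \<Omega> p (\<lambda>x. ?f e x / m e powr (1 / \<pi>)) \<le> 1"
    if "0 < m e \<and> m e \<le> 1 \<and> ball x0 e \<subseteq> \<Omega> \<and> (\<forall>x\<in>ball x0 e. p x \<le> \<pi>)" for e
    using modular_indicator_le_1[OF \<Omega>, of "ball x0 e"] that \<pi> by (simp add: m_def)
  have norm: "var_Lebesgue_norm \<Omega> p (?f e) \<le> ennreal (m e powr (1 / \<pi>))"
    if "0 < m e \<and> m e \<le> 1 \<and> ball x0 e \<subseteq> \<Omega> \<and> (\<forall>x\<in>ball x0 e. p x \<le> \<pi>)" for e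
    using that modular[OF that] by (intro var_Lebesgue_norm_le) auto
  show "\<not> (var_Lebesgue \<Omega> p \<hookrightarrow> Lebesgue \<Omega> r) \<and>
      (\<forall>s::ennreal. 0 < s \<longrightarrow> \<not> (var_Lorentz \<Omega> p q \<hookrightarrow> Lorentz \<Omega> r s))"
  proof (intro conjI allI impI)
    show "\<not> (var_Lebesgue \<Omega> p \<hookrightarrow> Lebesgue \<Omega> r)"
    proof (rule not_continuously_embeddedI[OF _ m0 _ _ _ powers])
      show "\<forall>\<^sub>F e in at_right 0. 0 < m e \<and> ?f e \<in> fst (var_Lebesgue \<Omega> p) \<and>
          snd (var_Lebesgue \<Omega> p) (?f e) \<le> ennreal (1 * m e powr (1 / \<pi>)) \<and>
          ennreal (1 * m e powr (1 / r)) \<le> snd (Lebesgue \<Omega> r) (?f e)"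
        using small
      proof eventually_elim
        case (elim e)
        \<comment> \<open>The scale that bounds the quasi-norm also witnesses membership in the
          space.\<close>
        have "modular \<Omega> p (\<lambda>x. ?f e x / m e powr (1 / \<pi>)) < \<infinity>"
          using modular[OF elim] by (rule le_less_trans) simp
        then have "?f e \<in> fst (var_Lebesgue \<Omega> p)"
          using elim meas[of e] by (auto simp: var_Lebesgue_def intro!: exI[of _ "m e powr (1 / \<pi>)"])
        then show ?case
          using elim norm[OF elim] \<Omega>
          by (simp add: var_Lebesgue_def Lebesgue_def Lebesgue_norm_indicator m_def)
      qed
    qed auto
  next
    fix s :: ennreal
    assume s: "0 < s"
    \<comment> \<open>Both constants depend on \<open>q\<close>, \<open>r\<close> and
      \<open>s\<close> but not on the radius, as the criterion requires.\<close>
    define K where "K = (if q = \<infinity> then 1 else (1 / enn2real q) powr (1 / enn2real q))"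
    define L where "L = (1 / 2) powr (1 / r) * (if s = \<infinity> then 1 else (1 / 2) powr (1 / enn2real s))"
    show "\<not> (var_Lorentz \<Omega> p q \<hookrightarrow> Lorentz \<Omega> r s)"
    proof (rule not_continuously_embeddedI[OF _ m0 _ _ _ powers])
      show "\<forall>\<^sub>F e in at_right 0. 0 < m e \<and> ?f e \<in> fst (var_Lorentz \<Omega> p q) \<and>
          snd (var_Lorentz \<Omega> p q) (?f e) \<le> ennreal (K * m e powr (1 / \<pi>)) \<and>
          ennreal (L * m e powr (1 / r)) \<le> snd (Lorentz \<Omega> r s) (?f e)"
        using small
      proof eventually_elim
        case (elim e)
        have le: "var_Lorentz_norm \<Omega> p q (?f e) \<le> ennreal (K * m e powr (1 / \<pi>))"
          unfolding K_def using elim norm[OF elim] assms(5)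
          by (intro var_Lorentz_norm_indicator_le) auto
        then have "var_Lorentz_norm \<Omega> p q (?f e) < \<infinity>"
          by (rule le_less_trans) simp
        moreover have "ennreal (L * m e powr (1 / r)) \<le> Lorentz_norm \<Omega> r s (?f e)"
          unfolding L_def m_def using elim \<Omega> \<pi> s
          by (intro Lorentz_norm_indicator_ge) (auto simp: m_def)
        ultimately show ?case
          using elim meas[of e] le by (simp add: var_Lorentz_def Lorentz_def)
      qed
    qed (auto simp: K_def L_def)
  qed
qed

end
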